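(* Let $\lambda>-1/2$, $\lambda\neq1/2$, $z>0$, and let $\gamma_n=\gamma_n(z;\lambda)$ be the coefficients of the three-term recurrence relation $xP_n(x)=P_{n+1}(x)+\gamma_nP_{n-1}(x)$ satisfied by the monic polynomials $(P_n)_{n\ge0}$ orthogonal with respect to the weight $(1-x^2)^{\lambda-1/2}e^{-zx^2}$ on $(-1,1)$, with $\gamma_0=0$. Then for every $n\ge1$, $$\gamma_n\left(n+\lambda-z(\gamma_{n+1}+\gamma_n)\right)\left(n-1+\lambda-z(\gamma_n+\gamma_{n-1})\right)=\left(\frac n2-z\gamma_n\right)\left(\frac{n-1}{2}+\lambda-z\gamma_n\right).$$
   Context: The monic orthogonal polynomials satisfy $\deg P_n=n$ and $\int_{-1}^1P_nP_m(1-x^2)^{\lambda-1/2}e^{-zx^2}dx=0$ for $n\ne m$; since the weight is even, the recurrence has the stated form for $n\ge0$ with $P_{-1}=0$, $P_0=1$. *)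

theory Defs
  imports "HOL-Analysis.Analysis" "HOL-Computational_Algebra.Polynomial"
begin

definition weight :: "real \<Rightarrow> real \<Rightarrow> real \<Rightarrow> real" where
  "weight lam z x = (1 - x\<^sup>2) powr (lam - 1/2) * exp (- z * x\<^sup>2)"

text \<open>
  For \<open>lam > -1/2\<close> and \<open>P n\<close> of degree \<open>n\<close> for every \<open>n\<close>, all integrands below are Lebesgue
  integrable on the open interval, so the default value of the Bochner integral plays no role.
\<close>

definition monic_orthogonal_polys :: "real \<Rightarrow> real \<Rightarrow> (nat \<Rightarrow> real poly) \<Rightarrow> bool" where
  "monic_orthogonal_polys lam z P \<longleftrightarrow>
     (\<forall>n. degree (P n) = n \<and> lead_coeff (P n) = 1) \<and>
     (\<forall>n m. n \<noteq> m \<longrightarrow>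
        (LBINT x:{-1<..<1}. poly (P n) x * poly (P m) x * weight lam z x) = 0)"

text \<open>
  The convention \<open>P\<^sub>-\<^sub>1 = 0\<close> is encoded by the case distinction. It leaves the coefficient with
  index \<open>0\<close> undetermined, so the normalisation \<open>\<gamma> 0 = 0\<close> is imposed separately.
\<close>

definition recurrence_coeffs :: "(nat \<Rightarrow> real poly) \<Rightarrow> (nat \<Rightarrow> real) \<Rightarrow> bool" where
  "recurrence_coeffs P \<gamma> \<longleftrightarrow>
     \<gamma> 0 = 0 \<and>
     (\<forall>n. [:0, 1:] * P n = P (Suc n) + smult (\<gamma> n) (if n = 0 then 0 else P (n - 1)))"

end

theory Submission imports Defs begin

text \<open>
  Integrating the derivative of \<open>(1 - x\<^sup>2) w(x) p(x)\<close>, which vanishes at both endpoints, gives a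
  Pearson identity for the moment functional of the weight \<open>w\<close>. Taken at \<open>p = P\<^sub>n P\<^sub>n\<^sub>-\<^sub>1\<close>, it
  expresses \<open>\<gamma>\<^sub>n\<close> and its neighbours through the subleading coefficient
  \<open>- (\<gamma>\<^sub>0 + \<dots> + \<gamma>\<^sub>n\<^sub>-\<^sub>1)\<close> of \<open>P\<^sub>n\<close>. Differencing in \<open>n\<close> removes that sum and leaves, for
  \<open>A\<^sub>n = n + \<lambda> - z (\<gamma>\<^sub>n\<^sub>+\<^sub>1 + \<gamma>\<^sub>n)\<close>, the equation
  \<open>\<gamma>\<^sub>n\<^sub>+\<^sub>1 (A\<^sub>n\<^sub>+\<^sub>1 + z) - \<gamma>\<^sub>n (A\<^sub>n\<^sub>-\<^sub>1 + z) = 1/2\<close>, for which \<open>A\<^sub>n\<close> is an integrating factor.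
\<close>

section \<open>Orthogonal polynomials for an abstract linear functional\<close>

locale orthogonal_recurrence =
  fixes L :: "real poly \<Rightarrow> real" and P :: "nat \<Rightarrow> real poly" and \<gamma> :: "nat \<Rightarrow> real"
  assumes L_add: "L (p + q) = L p + L q"
    and L_smult: "L (smult c p) = c * L p"
    and degree_P: "degree (P n) = n"
    and lead_coeff_P: "lead_coeff (P n) = 1"
    and orthogonal: "n \<noteq> m \<Longrightarrow> L (P n * P m) = 0"
    and nondegenerate: "L (P n * P n) \<noteq> 0"
    and recurrence: "recurrence_coeffs P \<gamma>"
begin

lemma L_diff: "L (p - q) = L p - L q"
  using L_add[of "p - q" q] by simp

lemma L_0: "L 0 = 0"
  using L_smult[of 0 0] by simp

lemma coeff_P_self: "coeff (P n) n = 1"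
  using lead_coeff_P[of n] by (simp add: degree_P)

lemma coeff_P_above: "n < i \<Longrightarrow> coeff (P n) i = 0"
  by (simp add: coeff_eq_0 degree_P)

lemma gamma_0: "\<gamma> 0 = 0"
  using recurrence by (simp add: recurrence_coeffs_def)

lemma recurrence_0: "[:0, 1:] * P 0 = P (Suc 0)"
  using recurrence[unfolded recurrence_coeffs_def, THEN conjunct2, rule_format, of 0] by simp

lemma recurrence_Suc: "[:0, 1:] * P (Suc n) = P (Suc (Suc n)) + smult (\<gamma> (Suc n)) (P n)"
  using recurrence[unfolded recurrence_coeffs_def, THEN conjunct2, rule_format, of "Suc n"] by simp

text \<open>Induction on \<open>k\<close>: subtracting a multiple of \<open>P k\<close> removes the
  top coefficient of \<open>q\<close>. Bounding \<open>q\<close> by vanishing coefficients instead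
  of by degree lets \<open>k = 0\<close> mean \<open>q = 0\<close>.\<close>

lemma L_P_mult_lower:
  assumes "k \<le> n" and "\<And>i. k \<le> i \<Longrightarrow> coeff q i = 0"
  shows "L (P n * q) = 0"
  using assms
proof (induction k arbitrary: q)
  case 0
  then have "q = 0" by (intro poly_eqI) simp
  then show ?case by (simp add: L_0)
next
  case (Suc k)
  define r where "r = q - smult (coeff q k) (P k)"
  have "coeff r i = 0" if "k \<le> i" for i
    using that Suc.prems(2)[of i]
    by (cases "i = k") (auto simp: r_def coeff_P_self coeff_P_above)
  then have "L (P n * r) = 0"
    using Suc.IH[of r] Suc.prems(1) by simp
  moreover have "P n * q = P n * r + smult (coeff q k) (P n * P k)"
    by (simp add: r_def algebra_simps)
  moreover have "L (P n * P k) = 0"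
    using Suc.prems(1) by (intro orthogonal) simp
  ultimately show ?case by (simp add: L_add L_smult)
qed

text \<open>Splitting off a multiple of \<open>P n\<close> leaves only coefficients below
  \<open>n\<close>, which \<open>L_P_mult_lower\<close> annihilates. The pairings below are
  evaluated this way, by reading off one coefficient.\<close>

lemma L_P_mult:
  assumes "degree q \<le> n"
  shows "L (P n * q) = coeff q n * L (P n * P n)"
proof -
  define r where "r = q - smult (coeff q n) (P n)"
  have "coeff r i = 0" if "n \<le> i" for i
    using that assms
    by (cases "i = n") (auto simp: r_def coeff_P_self coeff_P_above coeff_eq_0)
  then have "L (P n * r) = 0"
    by (intro L_P_mult_lower[of n]) auto
  moreover have "P n * q = P n * r + smult (coeff q n) (P n * P n)"
    by (simp add: r_def algebra_simps)
  ultimately show ?thesis by (simp add: L_add L_smult)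
qed

text \<open>Multiplication by x can act on either factor of the pairing: on \<open>P (Suc m)\<close>
  the recurrence applies, on \<open>P m\<close> the leading coefficient decides.\<close>

lemma norm_Suc: "L (P (Suc m) * P (Suc m)) = \<gamma> (Suc m) * L (P m * P m)"
proof -
  have "L (P m * ([:0, 1:] * P (Suc m))) = \<gamma> (Suc m) * L (P m * P m)"
    unfolding recurrence_Suc by (simp add: distrib_left L_add L_smult orthogonal)
  moreover have "L (P (Suc m) * ([:0, 1:] * P m)) = L (P (Suc m) * P (Suc m))"
    by (subst L_P_mult) (auto simp: degree_P coeff_P_self intro!: degree_pCons_le)
  moreover have "P m * ([:0, 1:] * P (Suc m)) = P (Suc m) * ([:0, 1:] * P m)"
    by (simp only: mult_ac)
  ultimately show ?thesis by metis
qed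

lemma coeff_P_pred: "coeff (P (Suc n)) n = 0"
proof (induction n)
  case 0
  have "coeff ([:0, 1:] * P 0) 0 = 0" by simp
  then show ?case unfolding recurrence_0 .
next
  case (Suc n)
  have "coeff ([:0, 1:] * P (Suc n)) (Suc n) = coeff (P (Suc n)) n" by simp
  then show ?case unfolding recurrence_Suc using Suc by (simp add: coeff_P_above)
qed

text \<open>Comparing coefficients in the recurrence contributes one further
  \<open>- \<gamma> k\<close> at each step.\<close>

lemma coeff_P_pred2: "coeff (P (Suc (Suc n))) n = - (\<Sum>k\<le>Suc n. \<gamma> k)"
proof (induction n)
  case 0
  have "coeff ([:0, 1:] * P (Suc 0)) 0 = 0" by simp
  then show ?case unfolding recurrence_Suc by (simp add: coeff_P_self gamma_0)
next
  case (Suc n)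
  have "coeff ([:0, 1:] * P (Suc (Suc n))) (Suc n) = coeff (P (Suc (Suc n))) n" by simp
  then show ?case unfolding recurrence_Suc using Suc by (simp add: coeff_P_self)
qed

text \<open>The two highest terms of \<open>x P' - (m + 2) P\<close>, \<open>P = P (m + 2)\<close>, cancel.\<close>

lemma L_P_mult_x_pderiv:
  "L (P m * ([:0, 1:] * pderiv (P (Suc (Suc m))))) = 2 * (\<Sum>k\<le>Suc m. \<gamma> k) * L (P m * P m)"
proof -
  let ?q = "P (Suc (Suc m))"
  define r where "r = [:0, 1:] * pderiv ?q - smult (real (Suc (Suc m))) ?q"
  have c: "coeff r i = (real i - real (Suc (Suc m))) * coeff ?q i" for i
    by (cases i) (simp_all add: r_def coeff_pderiv algebra_simps)
  have "degree r \<le> m"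
  proof (rule degree_le, intro allI impI)
    fix i assume "m < i"
    then consider "i = Suc m" | "i = Suc (Suc m)" | "Suc (Suc m) < i" by linarith
    then show "coeff r i = 0"
      by cases (simp_all add: c coeff_P_pred coeff_P_above)
  qed
  then have "L (P m * r) = 2 * (\<Sum>k\<le>Suc m. \<gamma> k) * L (P m * P m)"
    by (subst L_P_mult) (simp_all add: c coeff_P_pred2)
  moreover have "P m * ([:0, 1:] * pderiv ?q) = P m * r + smult (real (Suc (Suc m))) (P m * ?q)"
    by (simp add: r_def algebra_simps)
  ultimately show ?thesis by (simp only: L_add L_smult) (simp add: orthogonal)
qed

lemma L_pderiv_mult: "L (P m * pderiv (P (Suc m))) = real (Suc m) * L (P m * P m)"
  by (subst L_P_mult) (simp_all add: degree_pderiv degree_P coeff_pderiv coeff_P_self)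

text \<open>One factor x of x^2 is absorbed into \<open>P m\<close> by the recurrence. The resulting
  \<open>P (m - 1)\<close> term is covered by \<open>L_P_mult_x_pderiv\<close>, and
  \<open>norm_Suc\<close> converts its norm to that of \<open>P m\<close>.\<close>

lemma L_P_Suc_mult_x_pderiv:
  "L (P m * ([:0, 0, 1:] * pderiv (P (Suc m)))) =
     (real (Suc m) * \<gamma> (Suc m) + 2 * (\<Sum>k\<le>m. \<gamma> k)) * L (P m * P m)"
proof -
  have x: "L (P (Suc m) * ([:0, 1:] * pderiv (P (Suc m)))) =
      real (Suc m) * \<gamma> (Suc m) * L (P m * P m)"
    by (subst L_P_mult)
      (auto simp: degree_pderiv degree_P coeff_pderiv coeff_P_self norm_Suc
        intro!: order.trans[OF degree_pCons_le])
  have e: "P m * ([:0, 0, 1:] * pderiv (P (Suc m))) =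
      ([:0, 1:] * P m) * ([:0, 1:] * pderiv (P (Suc m)))"
    by (simp add: poly_eq_poly_eq_iff[symmetric] fun_eq_iff algebra_simps)
  show ?thesis
  proof (cases m)
    case 0
    then show ?thesis using x unfolding e by (simp only: recurrence_0 gamma_0) (simp add: gamma_0)
  next
    case (Suc k)
    have "L (P k * ([:0, 1:] * pderiv (P (Suc m)))) = 2 * (\<Sum>k\<le>m. \<gamma> k) * L (P k * P k)"
      unfolding Suc by (rule L_P_mult_x_pderiv)
    moreover have "L (P m * P m) = \<gamma> m * L (P k * P k)"
      unfolding Suc by (rule norm_Suc)
    moreover have "L (P m * ([:0, 0, 1:] * pderiv (P (Suc m)))) =
        L (P (Suc m) * ([:0, 1:] * pderiv (P (Suc m)))) +
        \<gamma> m * L (P k * ([:0, 1:] * pderiv (P (Suc m))))"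
      unfolding e unfolding Suc recurrence_Suc
      by (simp only: distrib_right L_add L_smult mult_smult_left)
    ultimately show ?thesis using x by (simp add: algebra_simps)
  qed
qed

text \<open>Only the coefficient at \<open>Suc m\<close> counts; it comes from \<open>- x^2\<close>
  times the leading term of \<open>pderiv (P m)\<close>.\<close>

lemma L_one_minus_x2_pderiv:
  "L (P (Suc m) * ([:1, 0, -1:] * pderiv (P m))) = - real m * \<gamma> (Suc m) * L (P m * P m)"
proof -
  have c: "coeff ([:1, 0, -1:] * pderiv (P m)) i =
     coeff (pderiv (P m)) i - (if i < 2 then 0 else coeff (pderiv (P m)) (i - 2))" for i
    by (cases i; cases "i - 1") (auto simp: coeff_pCons split: nat.splits)
  have "degree ([:1, 0, -1:] * pderiv (P m)) \<le> Suc m"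
    by (rule degree_le, unfold c) (auto simp: coeff_pderiv coeff_P_above)
  then have "L (P (Suc m) * ([:1, 0, -1:] * pderiv (P m))) =
     coeff ([:1, 0, -1:] * pderiv (P m)) (Suc m) * (\<gamma> (Suc m) * L (P m * P m))"
    by (simp only: L_P_mult norm_Suc)
  also have "coeff ([:1, 0, -1:] * pderiv (P m)) (Suc m) = - real m"
    unfolding c by (cases m) (auto simp: coeff_pderiv coeff_P_above coeff_P_self)
  finally show ?thesis by simp
qed

lemma L_x_mult: "L (P m * P (Suc m) * [:0, 1:]) = \<gamma> (Suc m) * L (P m * P m)"
proof -
  have "P m * P (Suc m) * [:0, 1:] = P m * ([:0, 1:] * P (Suc m))"
    by (simp only: mult_ac)
  then show ?thesis
    unfolding recurrence_Suc by (simp add: distrib_left L_add L_smult orthogonal)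
qed

text \<open>One factor x goes to \<open>P m\<close> and two go to \<open>P (Suc m)\<close>; after
  expansion only pairings of equal indices survive.\<close>

lemma L_x3_mult:
  "L (P m * P (Suc m) * [:0, 0, 0, 1:]) =
     (\<gamma> (m + 2) + \<gamma> (m + 1) + \<gamma> m) * \<gamma> (Suc m) * L (P m * P m)"
proof -
  \<comment> \<open>\<open>Q\<close> is the preceding polynomial, zero for \<open>m = 0\<close>, so
    that the expansion needs no case split.\<close>
  define Q where "Q = (if m = 0 then 0 else P (m - 1))"
  have rec: "[:0, 1:] * P m = P (Suc m) + smult (\<gamma> m) Q"
    using recurrence by (simp add: recurrence_coeffs_def Q_def)
  have QQ: "\<gamma> m * L (Q * Q) = (if m = 0 then 0 else L (P m * P m))"
    using norm_Suc[of "m - 1"] by (auto simp: Q_def L_0)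
  have QP: "L (Q * P k) = 0" "L (P k * Q) = 0" if "m \<le> k" for k
    using that by (auto simp: Q_def L_0 intro!: orthogonal)
  have x2: "[:0, 1:] * ([:0, 1:] * P (Suc m)) =
    P (m + 3) + smult (\<gamma> (m + 2)) (P (Suc m)) + smult (\<gamma> (Suc m)) (P (Suc m) + smult (\<gamma> m) Q)"
    unfolding recurrence_Suc
    by (simp only: distrib_left mult_smult_right rec recurrence_Suc) (simp add: numeral_3_eq_3)
  have "P m * P (Suc m) * [:0, 0, 0, 1:] = ([:0, 1:] * P m) * ([:0, 1:] * ([:0, 1:] * P (Suc m)))"
    by (simp add: poly_eq_poly_eq_iff[symmetric] fun_eq_iff algebra_simps)
  also have "L \<dots> = (\<gamma> (m + 2) + \<gamma> (Suc m)) * L (P (Suc m) * P (Suc m)) +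
      \<gamma> (Suc m) * \<gamma> m * (\<gamma> m * L (Q * Q))"
    unfolding rec x2
    by (simp add: distrib_left distrib_right L_add L_smult orthogonal QP smult_add_right)
  finally show ?thesis
    unfolding QQ norm_Suc by (auto simp: algebra_simps gamma_0)
qed

end

section \<open>From the Pearson identity to the nonlinear recurrence\<close>

text \<open>The cubic is \<open>- ((1 - x^2) w)' / w\<close> for the weight \<open>w\<close>, that
  is \<open>(2 * lam + 1) x + 2 z x (1 - x^2)\<close>.\<close>

locale pearson_recurrence = orthogonal_recurrence +
  fixes lam z :: real
  assumes pearson: "L ([:1, 0, -1:] * pderiv p) = L (p * [:0, 2 * lam + 1 + 2 * z, 0, - 2 * z:])"
begin

lemma laguerre_freud:
  "\<gamma> (Suc m) * (lam + z + real (Suc m) - z * (\<gamma> (m + 2) + \<gamma> (m + 1) + \<gamma> m)) =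
     real (Suc m) / 2 - (\<Sum>k\<le>m. \<gamma> k)"
proof -
  let ?h = "L (P m * P m)"
  have "[:1, 0, -1:] * pderiv (P m * P (Suc m)) =
      P (Suc m) * ([:1, 0, -1:] * pderiv (P m)) +
      (P m * pderiv (P (Suc m)) - P m * ([:0, 0, 1:] * pderiv (P (Suc m))))"
    by (simp add: pderiv_mult poly_eq_poly_eq_iff[symmetric] fun_eq_iff algebra_simps)
  then have "L ([:1, 0, -1:] * pderiv (P m * P (Suc m))) =
      (- real m * \<gamma> (Suc m) + (real (Suc m) -
        (real (Suc m) * \<gamma> (Suc m) + 2 * (\<Sum>k\<le>m. \<gamma> k)))) * ?h"
    by (simp only: L_add L_diff L_one_minus_x2_pderiv L_pderiv_mult L_P_Suc_mult_x_pderiv)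
      (simp add: algebra_simps)
  moreover have "P m * P (Suc m) * [:0, 2 * lam + 1 + 2 * z, 0, - 2 * z:] =
      smult (2 * lam + 1 + 2 * z) (P m * P (Suc m) * [:0, 1:]) -
      smult (2 * z) (P m * P (Suc m) * [:0, 0, 0, 1:])"
    by (simp add: poly_eq_poly_eq_iff[symmetric] fun_eq_iff algebra_simps)
  then have "L (P m * P (Suc m) * [:0, 2 * lam + 1 + 2 * z, 0, - 2 * z:]) =
      ((2 * lam + 1 + 2 * z) * \<gamma> (Suc m) -
        2 * z * (\<gamma> (m + 2) + \<gamma> (m + 1) + \<gamma> m) * \<gamma> (Suc m)) * ?h"
    by (simp only: L_diff L_smult L_x_mult L_x3_mult) (simp add: algebra_simps)
  \<comment> \<open>Both sides are multiples of \<open>?h\<close>, which is nonzero and cancels,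
    leaving a relation among the coefficients alone.\<close>
  ultimately have "- real m * \<gamma> (Suc m) + (real (Suc m) -
        (real (Suc m) * \<gamma> (Suc m) + 2 * (\<Sum>k\<le>m. \<gamma> k))) =
      (2 * lam + 1 + 2 * z) * \<gamma> (Suc m) -
        2 * z * (\<gamma> (m + 2) + \<gamma> (m + 1) + \<gamma> m) * \<gamma> (Suc m)"
    using pearson[of "P m * P (Suc m)"] nondegenerate[of m] by simp
  then show ?thesis by (simp add: algebra_simps)
qed

text \<open>Subtracting consecutive instances cancels the products
  \<open>\<gamma> n * \<gamma> (n + 1)\<close>; the term \<open>- \<gamma> n\<close> left by the
  sums turns \<open>n\<close> into \<open>n - 1\<close> in the second bracket.\<close>

lemma laguerre_freud_diff:
  "\<gamma> (Suc n) * (real (Suc n) + lam - z * (\<gamma> (n + 2) + \<gamma> (n + 1)) + z) -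
   \<gamma> n * (real n - 1 + lam - z * (\<gamma> n + \<gamma> (n - 1)) + z) = 1 / 2"
proof (cases n)
  case 0
  then show ?thesis using laguerre_freud[of 0] by (simp add: gamma_0 algebra_simps)
next
  case (Suc m)
  then show ?thesis
    using laguerre_freud[of n] laguerre_freud[of m] by (simp add: algebra_simps)
qed

text \<open>The difference of the two sides is a first integral of \<open>laguerre_freud_diff\<close>; it vanishes
  at \<open>n = 0\<close>, where the truncated \<open>n - 1\<close> is harmless because of the factor \<open>\<gamma> 0 = 0\<close>.\<close>

lemma second_order_equation:
  "\<gamma> n * (real n + lam - z * (\<gamma> (n + 1) + \<gamma> n)) * (real n - 1 + lam - z * (\<gamma> n + \<gamma> (n - 1)))
     = (real n / 2 - z * \<gamma> n) * ((real n - 1) / 2 + lam - z * \<gamma> n)"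
proof (induction n)
  case 0
  then show ?case by (simp add: gamma_0)
next
  case (Suc n)
  define A where "A = real n + lam - z * (\<gamma> (n + 1) + \<gamma> n)"
  define B where "B = real n - 1 + lam - z * (\<gamma> n + \<gamma> (n - 1))"
  define C where "C = real (Suc n) + lam - z * (\<gamma> (n + 2) + \<gamma> (n + 1))"
  have e: "\<gamma> (Suc n) * C = \<gamma> n * B + 1 / 2 - z * (\<gamma> (Suc n) - \<gamma> n)"
    using laguerre_freud_diff[of n] by (simp add: B_def C_def algebra_simps)
  \<comment> \<open>Multiplying by \<open>A\<close> creates the required product at
    \<open>Suc n\<close> on the left and the one at \<open>n\<close> on the right.\<close>
  have "\<gamma> (Suc n) * C * A = \<gamma> n * A * B + A * (1 / 2 - z * (\<gamma> (Suc n) - \<gamma> n))"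
    unfolding e by (simp add: algebra_simps)
  also have "\<gamma> n * A * B = (real n / 2 - z * \<gamma> n) * ((real n - 1) / 2 + lam - z * \<gamma> n)"
    using Suc by (simp add: A_def B_def)
  \<comment> \<open>From \<open>n\<close> to \<open>Suc n\<close> both factors of the right-hand
    side grow by d = \<open>1 / 2 - z * (\<gamma> (Suc n) - \<gamma> n)\<close>. Since
    \<open>A\<close> is the new first factor plus the old second one, the product grows by exactly
    \<open>A\<close> d.\<close>
  finally show ?case
    by (simp add: A_def C_def field_simps)
qed

end

section \<open>Integrability against the weight\<close>

text \<open>With t = (1 + x)/2 one has 1 - x^2 = 4 t (1 - t), which reduces the claim to the Beta
  integrand with both parameters \<open>a + 1\<close>.\<close>

lemma set_integrable_gegenbauer_weight:
  fixes a :: real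
  assumes "a > -1"
  shows "set_integrable lborel {-1<..<1} (\<lambda>x. (1 - x\<^sup>2) powr a)"
proof -
  let ?f = "\<lambda>t::real. t powr ((a + 1) - 1) * (1 - t) powr ((a + 1) - 1)"
  have "set_integrable lborel {0..1} ?f"
    using assms by (intro integrable_Beta) auto
  then have "integrable lborel (\<lambda>x::real. indicator {0..1} (1/2 + 1/2 * x) *\<^sub>R ?f (1/2 + 1/2 * x))"
    unfolding set_integrable_def by (intro lborel_integrable_real_affine) auto
  then have "integrable lborel (\<lambda>x::real. 4 powr a * (indicator {0..1} (1/2 + 1/2 * x) *\<^sub>R ?f (1/2 + 1/2 * x)))"
    by (rule integrable_mult_right)
  also have "(\<lambda>x::real. 4 powr a * (indicator {0..1} (1/2 + 1/2 * x) *\<^sub>R ?f (1/2 + 1/2 * x))) =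
      (\<lambda>x. indicator {-1..1} x *\<^sub>R (1 - x\<^sup>2) powr a)"
  proof
    fix x :: real
    show "4 powr a * (indicator {0..1} (1/2 + 1/2 * x) *\<^sub>R ?f (1/2 + 1/2 * x)) =
        indicator {-1..1} x *\<^sub>R (1 - x\<^sup>2) powr a"
    proof (cases "x \<in> {-1..1}")
      case True
      have "1 - x\<^sup>2 = 4 * ((1/2 + 1/2 * x) * (1 - (1/2 + 1/2 * x)))"
        by (simp add: field_simps power2_eq_square)
      then have "(1 - x\<^sup>2) powr a = (4 * ((1/2 + 1/2 * x) * (1 - (1/2 + 1/2 * x)))) powr a"
        by (rule arg_cong)
      also have "\<dots> = 4 powr a * ?f (1/2 + 1/2 * x)"
        using True by (simp add: powr_mult)
      finally show ?thesis using True by simp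
    qed (auto simp: indicator_def field_simps)
  qed
  finally have "set_integrable lborel {-1..1} (\<lambda>x. (1 - x\<^sup>2) powr a)"
    by (simp add: set_integrable_def)
  then show ?thesis
    by (rule set_integrable_subset) auto
qed

lemma poly_measurable [measurable]: "poly (p :: real poly) \<in> borel_measurable borel"
  by (intro borel_measurable_continuous_onI continuous_intros)

text \<open>The polynomial and exponential factors are bounded on the compact interval, so a
  multiple of the Gegenbauer weight dominates.\<close>

lemma set_integrable_poly_weight:
  assumes "lam > - 1/2"
  shows "set_integrable lborel {-1<..<1} (\<lambda>x. poly p x * weight lam z x)"
proof -
  have "compact ((\<lambda>x. poly p x * exp (- z * x\<^sup>2)) ` {-1..1})"
    by (intro compact_continuous_image continuous_intros) auto
  then obtain B where B: "\<And>x. x \<in> {-1..1} \<Longrightarrow> \<bar>poly p x * exp (- z * x\<^sup>2)\<bar> \<le> B"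
    using compact_imp_bounded[THEN bounded_iff[THEN iffD1]] by fastforce
  have "set_integrable lborel {-1<..<1} (\<lambda>x. B * (1 - x\<^sup>2) powr (lam - 1/2))"
    using assms by (intro set_integrable_mult_right set_integrable_gegenbauer_weight) auto
  then show ?thesis
  proof (rule set_integrable_bound)
    show "set_borel_measurable lborel {-1<..<1} (\<lambda>x. poly p x * weight lam z x)"
      unfolding set_borel_measurable_def weight_def by measurable
    show "AE x in lborel. x \<in> {-1<..<1} \<longrightarrow>
        norm (poly p x * weight lam z x) \<le> norm (B * (1 - x\<^sup>2) powr (lam - 1/2))"
    proof (intro AE_I2 impI)
      fix x :: real assume "x \<in> {-1<..<1}"
      then have "\<bar>poly p x * exp (- z * x\<^sup>2)\<bar> \<le> \<bar>B\<bar>" using B[of x] by simp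
      from mult_right_mono[OF this, of "(1 - x\<^sup>2) powr (lam - 1/2)"]
      show "norm (poly p x * weight lam z x) \<le> norm (B * (1 - x\<^sup>2) powr (lam - 1/2))"
        by (simp add: weight_def abs_mult mult_ac)
    qed
  qed
qed

section \<open>The moment functional of the weight and its properties\<close>

definition moment_functional :: "real \<Rightarrow> real \<Rightarrow> real poly \<Rightarrow> real" where
  "moment_functional lam z p = (LBINT x:{-1<..<1}. poly p x * weight lam z x)"

lemma moment_functional_add:
  assumes "lam > - 1/2"
  shows "moment_functional lam z (p + q) = moment_functional lam z p + moment_functional lam z q"
  using set_integral_add(2)[OF set_integrable_poly_weight set_integrable_poly_weight, OF assms assms]
  by (simp add: moment_functional_def distrib_right)

lemma moment_functional_smult:
  "moment_functional lam z (smult c p) = c * moment_functional lam z p"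
  by (simp add: moment_functional_def mult.assoc)

text \<open>A nonnegative integrand with zero integral vanishes almost everywhere, but this one is
  positive on the interval off the finitely many roots of \<open>p\<close>.\<close>

lemma moment_functional_square_nonzero:
  assumes "lam > - 1/2" and "p \<noteq> 0"
  shows "moment_functional lam z (p * p) \<noteq> 0"
proof
  assume eq: "moment_functional lam z (p * p) = 0"
  let ?f = "\<lambda>x. indicator {-1<..<1} x *\<^sub>R (poly (p * p) x * weight lam z x)"
  have "integrable lborel ?f"
    using set_integrable_poly_weight[OF assms(1)] unfolding set_integrable_def .
  moreover have "AE x in lborel. 0 \<le> ?f x"
    by (intro AE_I2) (auto simp: weight_def indicator_def)
  moreover have "integral\<^sup>L lborel ?f = 0"
    using eq by (simp add: moment_functional_def set_lebesgue_integral_def)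
  ultimately have "AE x in lborel. ?f x = 0"
    using integral_nonneg_eq_0_iff_AE by blast
  moreover have "AE x in lborel. x \<notin> {x. poly p x = 0}"
    using poly_roots_finite[OF assms(2)]
    by (intro AE_not_in finite_imp_null_set_lborel)
  ultimately have "AE x in lborel. x \<notin> {-1<..<1::real}"
  proof eventually_elim
    case (elim x)
    then show ?case by (auto simp: weight_def indicator_def abs_square_eq_1 power2_eq_1_iff)
  qed
  then have "{-1<..<1::real} \<in> null_sets lborel"
    by (subst AE_iff_null_sets) auto
  then show False by (simp add: null_sets_def)
qed

text \<open>\<open>F\<close> is (1 - x^2) times the weight times \<open>p\<close>, and
  \<open>q\<close> is chosen so that \<open>F'\<close> equals \<open>q\<close> times the
  weight.\<close>

lemma moment_functional_pearson:
  assumes "lam > - 1/2"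
  shows "moment_functional lam z ([:1, 0, -1:] * pderiv p) =
    moment_functional lam z (p * [:0, 2 * lam + 1 + 2 * z, 0, - 2 * z:])"
proof -
  define F where "F x = (1 - x\<^sup>2) powr (lam + 1/2) * (exp (- z * x\<^sup>2) * poly p x)" for x
  define q where "q = [:1, 0, -1:] * pderiv p - p * [:0, 2 * lam + 1 + 2 * z, 0, - 2 * z:]"
  have F': "(F has_real_derivative poly q x * weight lam z x) (at x)" if "\<bar>x\<bar> < 1" for x
  proof -
    have pos: "1 - x\<^sup>2 > 0" using that by (simp add: abs_square_less_1)
    then have pow: "(1 - x\<^sup>2) powr (lam + 1/2) = (1 - x\<^sup>2) * (1 - x\<^sup>2) powr (lam - 1/2)"
      using powr_add[of "1 - x\<^sup>2" 1 "lam - 1/2"] by (simp add: add.commute)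
    have "((\<lambda>x. (1 - x\<^sup>2) powr (lam + 1/2)) has_real_derivative
        (lam + 1/2) * (1 - x\<^sup>2) powr (lam + 1/2 - of_nat 1) * (- 2 * x)) (at x)"
      using pos by (intro DERIV_fun_powr) (auto intro!: derivative_eq_intros)
    moreover have "((\<lambda>x. exp (- z * x\<^sup>2) * poly p x) has_real_derivative
        exp (- z * x\<^sup>2) * (poly (pderiv p) x - 2 * z * x * poly p x)) (at x)"
      by (auto intro!: derivative_eq_intros simp: algebra_simps)
    ultimately have "(F has_real_derivative
        (lam + 1/2) * (1 - x\<^sup>2) powr (lam + 1/2 - of_nat 1) * (- 2 * x) *
          (exp (- z * x\<^sup>2) * poly p x) +
        exp (- z * x\<^sup>2) * (poly (pderiv p) x - 2 * z * x * poly p x) *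
          (1 - x\<^sup>2) powr (lam + 1/2)) (at x)"
      unfolding F_def by (rule DERIV_mult)
    moreover have "lam + 1/2 - of_nat 1 = lam - 1/2" by simp
    ultimately show ?thesis
      by (simp only: pow) (simp add: q_def weight_def algebra_simps power2_eq_square)
  qed
  have cont: "isCont (\<lambda>x. poly q x * weight lam z x) x" if "\<bar>x\<bar> < 1" for x
    unfolding weight_def using that
    by (intro continuous_intros) (auto simp: power2_eq_1_iff)
  \<comment> \<open>The exponent \<open>lam + 1/2\<close> is positive, so \<open>F\<close> is
    continuous up to the endpoints and vanishes there.\<close>
  have F_cont: "continuous_on {-1..1} F"
    unfolding F_def using assms
    by (intro continuous_intros continuous_on_powr') (auto simp: abs_square_le_1)
  have F_end: "F 1 = 0" "F (-1) = 0"
    by (auto simp: F_def)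
  \<comment> \<open>The weight is unbounded near the endpoints when \<open>lam < 1/2\<close>, so the
    fundamental theorem is used in its form with one-sided limits.\<close>
  have "(LBINT x=ereal (-1)..ereal 1. poly q x * weight lam z x) = 0 - 0"
  proof (rule interval_integral_FTC_integrable[where F = F])
    show "set_integrable lborel (einterval (ereal (-1)) (ereal 1)) (\<lambda>x. poly q x * weight lam z x)"
      using set_integrable_poly_weight[OF assms]
      by (simp add: einterval_def greaterThanLessThan_def greaterThan_def lessThan_def Int_def)
    show "(F has_vector_derivative poly q x * weight lam z x) (at x)"
      if "ereal (-1) < ereal x" "ereal x < ereal 1" for x
      using that F'[of x] by (auto simp: has_real_derivative_iff_has_vector_derivative)
    show "isCont (\<lambda>x. poly q x * weight lam z x) x" if "ereal (-1) < ereal x" "ereal x < ereal 1" for x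
      using that cont[of x] by auto
    show "((F \<circ> real_of_ereal) \<longlongrightarrow> 0) (at_right (ereal (-1)))"
      using continuous_on_Icc_at_rightD[OF F_cont] F_end by (simp add: ereal_tendsto_simps1)
    show "((F \<circ> real_of_ereal) \<longlongrightarrow> 0) (at_left (ereal 1))"
      using continuous_on_Icc_at_leftD[OF F_cont] F_end by (simp add: ereal_tendsto_simps1 del: ereal_eq_1)
  qed auto
  then have "moment_functional lam z q = 0"
    by (simp add: moment_functional_def interval_lebesgue_integral_def einterval_def
      greaterThanLessThan_def greaterThan_def lessThan_def Int_def)
  then show ?thesis
    using moment_functional_add[OF assms, of z q "p * [:0, 2 * lam + 1 + 2 * z, 0, - 2 * z:]"]
    by (simp add: q_def)
qed

theorem theorem4p3:
  fixes lam z :: real and P :: "nat \<Rightarrow> real poly" and \<gamma> :: "nat \<Rightarrow> real" and n :: nat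
  assumes "lam > - 1/2" and "lam \<noteq> 1/2" and "z > 0"
    and "monic_orthogonal_polys lam z P"
    and "recurrence_coeffs P \<gamma>"
    and "n \<ge> 1"
  shows "\<gamma> n * (real n + lam - z * (\<gamma> (n + 1) + \<gamma> n))
             * (real n - 1 + lam - z * (\<gamma> n + \<gamma> (n - 1)))
         = (real n / 2 - z * \<gamma> n) * ((real n - 1) / 2 + lam - z * \<gamma> n)"
proof -
  have deg: "degree (P k) = k" and lead: "lead_coeff (P k) = 1" for k
    using assms(4) unfolding monic_orthogonal_polys_def by blast+
  \<comment> \<open>The analytic facts about the integral enter only here, as instances of the
    locale assumptions.\<close>
  interpret pearson_recurrence "moment_functional lam z" P \<gamma> lam z
  proof
    fix p q :: "real poly" and c :: real and k m :: nat
    show "moment_functional lam z (p + q) = moment_functional lam z p + moment_functional lam z q"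
      using assms(1) by (rule moment_functional_add)
    show "moment_functional lam z (smult c p) = c * moment_functional lam z p"
      by (rule moment_functional_smult)
    show "degree (P k) = k" "lead_coeff (P k) = 1"
      by (fact deg lead)+
    show "moment_functional lam z (P k * P m) = 0" if "k \<noteq> m"
      using assms(4) that by (simp add: monic_orthogonal_polys_def moment_functional_def)
    have "P k \<noteq> 0" using lead[of k] by auto
    then show "moment_functional lam z (P k * P k) \<noteq> 0"
      using assms(1) by (intro moment_functional_square_nonzero)
    show "recurrence_coeffs P \<gamma>" by fact
    show "moment_functional lam z ([:1, 0, -1:] * pderiv p) =
        moment_functional lam z (p * [:0, 2 * lam + 1 + 2 * z, 0, - 2 * z:])"
      using assms(1) by (rule moment_functional_pearson)
  qed
  show ?thesis by (rule second_order_equation)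
qed

end
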